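(* Let $d\ge 1$, let $M_d=M_d(\beta)$ be a real bivariate moment matrix, let $1\le n,m\le d$, let $p\in\mathcal P_{n-1}$, and let $q\in\mathcal P_m$ be a polynomial all of whose terms $x^uy^v$ satisfy $v<m$. Suppose $M_d$ is positive semidefinite and that its column dependence relations are generated entirely by $X^n=p(X,Y)$ and $Y^m=q(X,Y)$ via recursiveness and linearity. If $d=n+m-2$, then $M_d$ admits a flat moment matrix extension $M_{d+1}$ (and $\beta$ admits a $\operatorname{rank}M_d$-atomic representing measure).
   Context: $\mathcal P_k$ is the space of real polynomials in $x,y$ of total degree at most $k$; for $f\in\mathcal P_k$, $\hat f$ is its coefficient vector with respect to the monomials in degree-lexicographic order $1,x,y,x^2,xy,y^2,\ldots$. For a real sequence $\beta=\{\beta_{ij}\}_{i,j\ge0,\,i+j\le 2d}$, the moment matrix $M_d=M_d(\beta)$ has rows and columns indexed by the monomials of degree at most $d$ (denoted $1,X,Y,\ldots,X^d,\ldots,Y^d$), and the entry in row $X^iY^j$, column $X^kY^l$ is $\beta_{i+k,j+l}$. For $f=\sum a_{ij}x^iy^j\in\mathcal P_d$, $f(X,Y):=\sum a_{ij}X^iY^j=M_d\hat f$ (a combination of columns). "The column dependence relations of $M_d$ are generated entirely by $X^n=p(X,Y)$ and $Y^m=q(X,Y)$ via recursiveness and linearity" means that $\ker M_d$ is exactly the span of the vectors $\widehat{x^iy^j(x^n-p)}$ ($i,j\ge0$, $i+j+n\le d$) and $\widehat{x^ky^l(y^m-q)}$ ($k,l\ge0$, $k+l+m\le d$). A flat extension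 $M_{d+1}$ of $M_d$ is a positive semidefinite moment matrix $M_{d+1}(\beta^{(2d+2)})$, for some real sequence $\beta^{(2d+2)}$ of degree $2d+2$ extending $\beta$, with $\operatorname{rank}M_{d+1}=\operatorname{rank}M_d$. A representing measure for $\beta$ is a positive Borel measure $\mu$ on $\mathbb R^2$ with $\beta_{ij}=\int x^iy^j\,d\mu$ for all $i,j\ge0$, $i+j\le 2d$; it is $r$-atomic if its support consists of exactly $r$ points. *)

theory Defs
  imports
    "HOL-Analysis.Analysis"
    "HOL-Library.Poly_Mapping"
    "HOL-Library.Product_Plus"
    "Jordan_Normal_Form.Matrix_Kernel"
    "Jordan_Normal_Form.DL_Rank"
begin

text \<open>
  The ring of real polynomials in \<open>x, y\<close> is the monoid algebra of \<open>nat \<times> nat\<close>: the key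
  \<open>(i, j)\<close> stands for the monomial \<open>x^i y^j\<close>, and multiplication is convolution.
\<close>

type_synonym bipoly = "(nat \<times> nat) \<Rightarrow>\<^sub>0 real"

definition monom_xy :: "nat \<Rightarrow> nat \<Rightarrow> bipoly" where
  "monom_xy i j = Poly_Mapping.single (i, j) 1"

definition polys_upto :: "nat \<Rightarrow> bipoly set" where
  "polys_upto k = {f. \<forall>(i, j) \<in> Poly_Mapping.keys f. i + j \<le> k}"

text \<open>Degree-lexicographic order: \<open>1, x, y, x^2, xy, y^2, \<dots>\<close>\<close>

definition monomials :: "nat \<Rightarrow> (nat \<times> nat) list" where
  "monomials d = concat (map (\<lambda>k. map (\<lambda>j. (k - j, j)) [0..<Suc k]) [0..<Suc d])"

definition coeff_vec :: "nat \<Rightarrow> bipoly \<Rightarrow> real Matrix.vec" where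
  "coeff_vec d f =
     Matrix.vec (length (monomials d)) (\<lambda>r. Poly_Mapping.lookup f (monomials d ! r))"

text \<open>
  A sequence of degree \<open>2 * d\<close> is represented by a total function \<open>\<beta>\<close>, of which only the
  values \<open>\<beta> i j\<close> with \<open>i + j \<le> 2 * d\<close> are ever used.
\<close>

definition moment_matrix :: "nat \<Rightarrow> (nat \<Rightarrow> nat \<Rightarrow> real) \<Rightarrow> real Matrix.mat" where
  "moment_matrix d \<beta> =
     Matrix.mat (length (monomials d)) (length (monomials d))
       (\<lambda>(r, c). \<beta> (fst (monomials d ! r) + fst (monomials d ! c))
                   (snd (monomials d ! r) + snd (monomials d ! c)))"

definition psd_mat :: "real Matrix.mat \<Rightarrow> bool" where
  "psd_mat A \<longleftrightarrow> square_mat A \<and> transpose_mat A = A \<and>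
     (\<forall>v \<in> carrier_vec (dim_row A). 0 \<le> scalar_prod v (A *\<^sub>v v))"

abbreviation mat_rank :: "real Matrix.mat \<Rightarrow> nat" where
  "mat_rank A \<equiv> vec_space.rank (dim_row A) A"

abbreviation vec_span :: "nat \<Rightarrow> real Matrix.vec set \<Rightarrow> real Matrix.vec set" where
  "vec_span N S \<equiv> LinearCombinations.module.span class_ring (module_vec TYPE(real) N) S"

definition relations_generated ::
  "nat \<Rightarrow> (nat \<Rightarrow> nat \<Rightarrow> real) \<Rightarrow> nat \<Rightarrow> bipoly \<Rightarrow> nat \<Rightarrow> bipoly \<Rightarrow> bool" where
  "relations_generated d \<beta> n p m q \<longleftrightarrow>
     mat_kernel (moment_matrix d \<beta>) =
       vec_span (length (monomials d))
         ({coeff_vec d (monom_xy i j * (monom_xy n 0 - p)) | i j. i + j + n \<le> d} \<union>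
          {coeff_vec d (monom_xy k l * (monom_xy 0 m - q)) | k l. k + l + m \<le> d})"

text \<open>
  \<open>\<beta>'\<close> is a sequence of degree \<open>2 * d + 2\<close> whose moment matrix is a flat extension of that
  of \<open>\<beta>\<close>.
\<close>

definition flat_extension ::
  "nat \<Rightarrow> (nat \<Rightarrow> nat \<Rightarrow> real) \<Rightarrow> (nat \<Rightarrow> nat \<Rightarrow> real) \<Rightarrow> bool" where
  "flat_extension d \<beta> \<beta>' \<longleftrightarrow>
     (\<forall>i j. i + j \<le> 2 * d \<longrightarrow> \<beta>' i j = \<beta> i j) \<and>
     psd_mat (moment_matrix (d + 1) \<beta>') \<and>
     mat_rank (moment_matrix (d + 1) \<beta>') = mat_rank (moment_matrix d \<beta>)"

definition representing_measure ::
  "nat \<Rightarrow> (nat \<Rightarrow> nat \<Rightarrow> real) \<Rightarrow> (real \<times> real) measure \<Rightarrow> bool" where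
  "representing_measure d \<beta> \<mu> \<longleftrightarrow> sets \<mu> = sets borel \<and>
     (\<forall>i j. i + j \<le> 2 * d \<longrightarrow>
        integrable \<mu> (\<lambda>(x, y). x ^ i * y ^ j) \<and>
        \<beta> i j = (\<integral>(x, y). x ^ i * y ^ j \<partial>\<mu>))"

text \<open>The (closed) topological support of a Borel measure.\<close>

definition measure_support :: "'a::topological_space measure \<Rightarrow> 'a set" where
  "measure_support \<mu> = {z. \<forall>U. open U \<and> z \<in> U \<longrightarrow> emeasure \<mu> U > 0}"

definition atomic :: "nat \<Rightarrow> 'a::topological_space measure \<Rightarrow> bool" where
  "atomic r \<mu> \<longleftrightarrow> finite (measure_support \<mu>) \<and> card (measure_support \<mu>) = r"

end

theory Submission
  imports Defs "HOL-Computational_Algebra.Fundamental_Theorem_Algebra"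
begin

text \<open>
  The relations \<open>x^n = p\<close> and \<open>y^m = q\<close> define, by recursion on the degree and then on the
  exponent of \<open>y\<close>, an infinite sequence \<open>\<gamma>\<close> from the moments \<open>\<beta> i j\<close> with \<open>i < n\<close>, \<open>j < m\<close>.
  Its Riesz functional \<open>L\<close> vanishes on the ideal generated by \<open>x^n - p\<close> and \<open>y^m - q\<close>, and it agrees
  with that of \<open>\<beta>\<close> up to degree \<open>2 * d\<close>, because every multiple of a generator in that degree splits as a
  monomial of degree at most \<open>d\<close> times an element of the kernel of the moment matrix. As
  \<open>(n - 1) + (m - 1) = d\<close>, every polynomial is congruent to one of degree at most \<open>d\<close>, so \<open>L\<close> is
  nonnegative on all squares.

  The null ideal of \<open>L\<close> has finite codimension, so it contains a nonzero univariate polynomial in \<open>x\<close> and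
  one in \<open>y\<close>; positivity forces both to be replaceable by products of distinct real linear factors.
  Lagrange interpolation on the resulting grid of points then writes \<open>L\<close> as a positive combination of point
  evaluations. The number of its atoms is the rank of every moment matrix of \<open>\<gamma>\<close> of degree at least \<open>d\<close>,
  which gives both the flat extension and the measure.
\<close>

subsection \<open>Riesz functionals and their null ideals\<close>

definition riesz :: "(nat \<Rightarrow> nat \<Rightarrow> real) \<Rightarrow> bipoly \<Rightarrow> real" where
  "riesz \<gamma> f = (\<Sum>k \<in> Poly_Mapping.keys f. Poly_Mapping.lookup f k * \<gamma> (fst k) (snd k))"

abbreviation const_xy :: "real \<Rightarrow> bipoly" where
  "const_xy c \<equiv> Poly_Mapping.single 0 c"

lemma bipoly_expand: "f = (\<Sum>k \<in> Poly_Mapping.keys f. Poly_Mapping.single k (Poly_Mapping.lookup f k))"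
proof (rule poly_mapping_eqI)
  fix k
  have "(\<Sum>l \<in> Poly_Mapping.keys f. Poly_Mapping.lookup (Poly_Mapping.single l (Poly_Mapping.lookup f l)) k)
      = (\<Sum>l \<in> Poly_Mapping.keys f. if l = k then Poly_Mapping.lookup f k else 0)"
    by (rule sum.cong) (auto simp: lookup_single)
  also have "\<dots> = Poly_Mapping.lookup f k"
    by (simp add: in_keys_iff)
  finally show "Poly_Mapping.lookup f k = Poly_Mapping.lookup (\<Sum>k \<in> Poly_Mapping.keys f.
      Poly_Mapping.single k (Poly_Mapping.lookup f k)) k"
    by (simp add: lookup_sum)
qed

lemma bipoly_induct [case_names single add]:
  assumes single: "\<And>k c. P (Poly_Mapping.single k c)"
    and add: "\<And>f g. P f \<Longrightarrow> P g \<Longrightarrow> P (f + g)"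
  shows "P (f :: bipoly)"
proof -
  have "P (\<Sum>k \<in> K. Poly_Mapping.single k (Poly_Mapping.lookup f k))" if "finite K" for K
    using that
  proof induction
    case empty
    then show ?case using single[of 0 0] by simp
  qed (simp add: add single)
  then show ?thesis
    by (subst bipoly_expand) simp
qed

lemma riesz_superset:
  assumes "finite K" "Poly_Mapping.keys f \<subseteq> K"
  shows "riesz \<gamma> f = (\<Sum>k \<in> K. Poly_Mapping.lookup f k * \<gamma> (fst k) (snd k))"
  unfolding riesz_def
  by (rule sum.mono_neutral_left) (use assms in \<open>auto simp: in_keys_iff\<close>)

lemma riesz_zero [simp]: "riesz \<gamma> 0 = 0"
  by (simp add: riesz_def)

lemma riesz_add: "riesz \<gamma> (f + g) = riesz \<gamma> f + riesz \<gamma> g"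
proof -
  let ?K = "Poly_Mapping.keys f \<union> Poly_Mapping.keys g"
  have "riesz \<gamma> h = (\<Sum>k \<in> ?K. Poly_Mapping.lookup h k * \<gamma> (fst k) (snd k))"
    if "h \<in> {f, g, f + g}" for h
    by (rule riesz_superset) (use that keys_add[of f g] in auto)
  then show ?thesis
    by (simp add: lookup_add algebra_simps sum.distrib)
qed

lemma riesz_minus: "riesz \<gamma> (- f) = - riesz \<gamma> f"
  using riesz_add[of \<gamma> f "- f"] by simp

lemma riesz_diff: "riesz \<gamma> (f - g) = riesz \<gamma> f - riesz \<gamma> g"
  using riesz_add[of \<gamma> f "- g"] by (simp add: riesz_minus)

lemma riesz_sum: "riesz \<gamma> (sum f I) = (\<Sum>i \<in> I. riesz \<gamma> (f i))"
  by (induction I rule: infinite_finite_induct) (simp_all add: riesz_add)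

lemma riesz_single: "riesz \<gamma> (Poly_Mapping.single k c) = c * \<gamma> (fst k) (snd k)"
  by (subst riesz_superset[of "{k}"]) (auto simp: keys_single)

lemma riesz_const_mult: "riesz \<gamma> (const_xy c * f) = c * riesz \<gamma> f"
  by (induction f rule: bipoly_induct) (simp_all add: mult_single riesz_single riesz_add algebra_simps)

lemma riesz_mult:
  assumes "finite K" "Poly_Mapping.keys f \<subseteq> K" "finite L" "Poly_Mapping.keys g \<subseteq> L"
  shows "riesz \<gamma> (f * g) = (\<Sum>k \<in> K. \<Sum>l \<in> L. Poly_Mapping.lookup f k * Poly_Mapping.lookup g l
    * \<gamma> (fst k + fst l) (snd k + snd l))"
proof -
  have exp: "h = (\<Sum>k \<in> K. Poly_Mapping.single k (Poly_Mapping.lookup h k))"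
    if "finite K" "Poly_Mapping.keys h \<subseteq> K" for h :: bipoly and K
    by (subst bipoly_expand, rule sum.mono_neutral_left) (use that in \<open>auto simp: in_keys_iff\<close>)
  show ?thesis
    by (subst exp[OF assms(1,2)], subst exp[OF assms(3,4)])
      (simp add: sum_product riesz_sum mult_single riesz_single)
qed

lemma monom_xy_mult: "monom_xy i j * monom_xy k l = monom_xy (i + k) (j + l)"
  by (simp add: monom_xy_def mult_single)

lemma monom_xy_0: "monom_xy 0 0 = 1"
  unfolding monom_xy_def zero_prod_def[symmetric] by simp

lemma const_monom_xy: "Poly_Mapping.single k c = const_xy c * monom_xy (fst k) (snd k)"
  by (simp add: monom_xy_def mult_single)

lemma monom_xy_power: "monom_xy i j = monom_xy 1 0 ^ i * monom_xy 0 1 ^ j"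
proof -
  have x: "monom_xy 1 0 ^ i = monom_xy i 0"
    by (induction i) (simp_all add: monom_xy_mult monom_xy_0)
  have y: "monom_xy 0 1 ^ j = monom_xy 0 j"
    by (induction j) (simp_all add: monom_xy_mult monom_xy_0)
  show ?thesis unfolding x y monom_xy_mult by simp
qed

text \<open>The constants and the two variables generate the ring. This form suits properties stable
  under products, such as acting on a fixed polynomial by a scalar modulo an ideal.\<close>

lemma bipoly_ring_induct [case_names const x y add mult]:
  assumes const: "\<And>c. P (const_xy c)"
    and x: "P (monom_xy 1 0)" and y: "P (monom_xy 0 1)"
    and add: "\<And>f g. P f \<Longrightarrow> P g \<Longrightarrow> P (f + g)"
    and mult: "\<And>f g. P f \<Longrightarrow> P g \<Longrightarrow> P (f * g)"
  shows "P f"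
proof (induction f rule: bipoly_induct)
  case (single k c)
  have pow: "P (f ^ i)" if "P f" for f i
    using const[of 1] that by (induction i) (auto intro: mult)
  show ?case
    by (subst const_monom_xy, subst monom_xy_power) (intro mult const pow x y)
qed (rule add)

text \<open>Evaluation at \<open>z\<close> is encoded as the Riesz functional of the moments of the
  Dirac measure at \<open>z\<close>, so that linearity is inherited from
  \<open>riesz\<close>.\<close>

definition peval :: "real \<times> real \<Rightarrow> bipoly \<Rightarrow> real" where
  "peval z = riesz (\<lambda>i j. fst z ^ i * snd z ^ j)"

lemma peval_simps:
  "peval z (f + g) = peval z f + peval z g"
  "peval z (f - g) = peval z f - peval z g"
  "peval z (const_xy c) = c"
  "peval z (monom_xy i j) = fst z ^ i * snd z ^ j"
  by (simp_all add: peval_def riesz_add riesz_diff riesz_single monom_xy_def)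

lemma peval_mult: "peval z (f * g) = peval z f * peval z g"
proof (induction f rule: bipoly_induct)
  case (single k c)
  show ?case
    by (induction g rule: bipoly_induct)
      (simp_all add: peval_def mult_single riesz_single riesz_add algebra_simps power_add)
qed (simp add: peval_simps algebra_simps)

text \<open>This is the radical of the bilinear form sending \<open>f\<close>, \<open>g\<close> to
  \<open>riesz \<gamma> (f * g)\<close>, in other words the kernel of the infinite moment matrix.
  Associativity of the product makes it an ideal.\<close>

definition null_ideal :: "(nat \<Rightarrow> nat \<Rightarrow> real) \<Rightarrow> bipoly set" where
  "null_ideal \<gamma> = {f. \<forall>g. riesz \<gamma> (f * g) = 0}"

lemma null_ideal_riesz: "f \<in> null_ideal \<gamma> \<Longrightarrow> riesz \<gamma> f = 0"
  unfolding null_ideal_def by (metis (mono_tags, lifting) mem_Collect_eq mult.right_neutral)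

lemma null_ideal_zero: "0 \<in> null_ideal \<gamma>"
  by (simp add: null_ideal_def)

lemma null_ideal_add: "f \<in> null_ideal \<gamma> \<Longrightarrow> g \<in> null_ideal \<gamma> \<Longrightarrow> f + g \<in> null_ideal \<gamma>"
  by (simp add: null_ideal_def riesz_add distrib_right)

lemma null_ideal_mult: "f \<in> null_ideal \<gamma> \<Longrightarrow> f * g \<in> null_ideal \<gamma>"
  by (simp add: null_ideal_def mult.assoc)

lemma null_ideal_mult': "f \<in> null_ideal \<gamma> \<Longrightarrow> g * f \<in> null_ideal \<gamma>"
  using null_ideal_mult[of f \<gamma> g] by (simp add: mult.commute)

lemma null_ideal_sum: "(\<And>i. i \<in> I \<Longrightarrow> f i \<in> null_ideal \<gamma>) \<Longrightarrow> sum f I \<in> null_ideal \<gamma>"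
  by (induction I rule: infinite_finite_induct) (auto intro: null_ideal_zero null_ideal_add)

lemma null_ideal_monomI:
  assumes "\<And>i j. riesz \<gamma> (f * monom_xy i j) = 0"
  shows "f \<in> null_ideal \<gamma>"
proof -
  have "riesz \<gamma> (f * g) = 0" for g
  proof (induction g rule: bipoly_induct)
    case (single k c)
    have "riesz \<gamma> (f * Poly_Mapping.single k c) = riesz \<gamma> (const_xy c * (f * monom_xy (fst k) (snd k)))"
      by (subst const_monom_xy) (simp add: mult.left_commute)
    then show ?case by (simp add: riesz_const_mult assms)
  qed (simp add: riesz_add distrib_left)
  then show ?thesis by (simp add: null_ideal_def)
qed

lemma null_ideal_cong_riesz: "f - g \<in> null_ideal \<gamma> \<Longrightarrow> riesz \<gamma> f = riesz \<gamma> g"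
  using null_ideal_riesz[of "f - g" \<gamma>] by (simp add: riesz_diff)

section \<open>Substitution of a bivariate polynomial into a univariate one\<close>

definition poly_subst :: "bipoly \<Rightarrow> real poly \<Rightarrow> bipoly" where
  "poly_subst t c = poly (map_poly const_xy c) t"

lemma map_poly_hom_add:
  fixes \<phi> :: "'a::comm_ring_1 \<Rightarrow> 'b::comm_ring_1"
  assumes "\<phi> 0 = 0" and "\<And>a b. \<phi> (a + b) = \<phi> a + \<phi> b"
  shows "map_poly \<phi> (p + q) = map_poly \<phi> p + map_poly \<phi> q"
  by (rule poly_eqI) (simp add: coeff_map_poly assms)

lemma map_poly_hom_mult:
  fixes \<phi> :: "'a::comm_ring_1 \<Rightarrow> 'b::comm_ring_1"
  assumes 0: "\<phi> 0 = 0" and add: "\<And>a b. \<phi> (a + b) = \<phi> a + \<phi> b"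
    and mult: "\<And>a b. \<phi> (a * b) = \<phi> a * \<phi> b"
  shows "map_poly \<phi> (p * q) = map_poly \<phi> p * map_poly \<phi> q"
proof (rule poly_eqI)
  fix k
  have sum: "\<phi> (sum g I) = (\<Sum>i\<in>I. \<phi> (g i))" for g :: "nat \<Rightarrow> 'a" and I
    by (induction I rule: infinite_finite_induct) (simp_all add: 0 add)
  show "coeff (map_poly \<phi> (p * q)) k = coeff (map_poly \<phi> p * map_poly \<phi> q) k"
    by (simp add: coeff_map_poly coeff_mult 0 sum mult)
qed

lemma poly_subst_add: "poly_subst t (p + q) = poly_subst t p + poly_subst t q"
  unfolding poly_subst_def by (subst map_poly_hom_add) (simp_all add: single_add)

lemma poly_subst_mult: "poly_subst t (p * q) = poly_subst t p * poly_subst t q"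
  unfolding poly_subst_def by (subst map_poly_hom_mult) (simp_all add: single_add mult_single)

lemma poly_subst_pCons: "poly_subst t (pCons a p) = const_xy a + t * poly_subst t p"
  unfolding poly_subst_def by (subst map_poly_pCons) simp_all

lemma poly_subst_0 [simp]: "poly_subst t 0 = 0"
  by (simp add: poly_subst_def)

lemma poly_subst_1 [simp]: "poly_subst t 1 = 1"
  unfolding one_pCons poly_subst_pCons by simp

lemma poly_subst_smult: "poly_subst t (Polynomial.smult a p) = const_xy a * poly_subst t p"
  using poly_subst_mult[of t "[:a:]" p] by (simp add: poly_subst_pCons)

lemma poly_subst_sum: "poly_subst t (sum f I) = (\<Sum>i\<in>I. poly_subst t (f i))"
  by (induction I rule: infinite_finite_induct) (simp_all add: poly_subst_add)

lemma poly_subst_monom: "poly_subst t (Polynomial.monom a k) = const_xy a * t ^ k"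
  unfolding poly_subst_def by (simp add: map_poly_monom poly_monom)

lemma peval_poly_subst: "peval z (poly_subst t p) = poly p (peval z t)"
proof (induction p)
  case 0
  then show ?case by (simp add: peval_def)
next
  case (pCons a p)
  then show ?case by (simp add: poly_subst_pCons peval_simps peval_mult)
qed

text \<open>A complex root exists. A real one splits off a linear factor; a nonreal one splits off
  the real quadratic having it as a root, written as a sum of squares because positivity will be
  applied to it.\<close>

lemma real_poly_factor:
  fixes c :: "real poly"
  assumes "degree c > 0"
  shows "(\<exists>a e. c = [:-a, 1:] * e) \<or> (\<exists>a b e. b \<noteq> 0 \<and> c = ([:-a, 1:]^2 + [:b^2:]) * e)"
proof -
  let ?C = "map_poly complex_of_real"
  have C_mult: "?C (p * q) = ?C p * ?C q" and C_add: "?C (p + q) = ?C p + ?C q" for p q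
    by (simp_all add: map_poly_hom_mult map_poly_hom_add)
  have "degree (?C c) = degree c"
    by (rule map_poly_degree_eq) (use assms in auto)
  then have "\<not> constant (poly (?C c))"
    using assms by (simp add: constant_degree)
  then obtain z where z: "poly (?C c) z = 0"
    using fundamental_theorem_of_algebra by blast
  show ?thesis
  proof (cases "Im z = 0")
    case True
    then have z_eq: "z = of_real (Re z)" by (simp add: complex_eq_iff)
    have "poly (?C p) (of_real x) = of_real (poly p x)" for p x
      by (induction p) (simp_all add: map_poly_pCons)
    then have "poly c (Re z) = 0" using z z_eq by (metis of_real_eq_0_iff)
    then show ?thesis by (auto simp: poly_eq_0_iff_dvd dvd_def)
  next
    case False
    define Q where "Q = [:- Re z, 1:]^2 + [:(Im z)^2:]"
    have Q_eq: "Q = [:(Re z)^2 + (Im z)^2, - 2 * Re z, 1:]"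
      by (simp add: Q_def power2_eq_square)
    have "poly (?C Q) z = 0"
      by (simp add: Q_eq map_poly_pCons complex_eq_iff algebra_simps power2_eq_square)
    moreover have "?C c = ?C Q * ?C (c div Q) + ?C (c mod Q)"
      by (metis C_add C_mult mult_div_mod_eq)
    ultimately have r: "poly (?C (c mod Q)) z = 0"
      using z by simp
    have "Q \<noteq> 0" "degree Q = 2" by (auto simp: Q_eq)
    then have "degree (c mod Q) \<le> 1"
      using degree_mod_less[of Q c] by auto
    then have mod: "c mod Q = [:coeff (c mod Q) 0, coeff (c mod Q) 1:]"
      by (intro poly_eqI) (auto simp: coeff_pCons coeff_eq_0 split: nat.splits)
    \<comment> \<open>A real polynomial of degree at most 1 that vanishes at a nonreal point is
      zero.\<close>
    have "c mod Q = 0"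
      using r False by (subst (asm) mod, subst mod) (auto simp: map_poly_pCons complex_eq_iff)
    then have "c = Q * (c div Q)"
      using mult_div_mod_eq[of Q c] by simp
    then show ?thesis
      using False unfolding Q_def by blast
  qed
qed

section \<open>Lagrange interpolation in one variable\<close>

definition lagrange :: "real set \<Rightarrow> real \<Rightarrow> real poly" where
  "lagrange A a = Polynomial.smult (1 / (\<Prod>b \<in> A - {a}. a - b)) (\<Prod>b \<in> A - {a}. [:-b, 1:])"

lemma poly_lagrange:
  assumes "finite A" "a \<in> A" "a' \<in> A"
  shows "poly (lagrange A a) a' = (if a' = a then 1 else 0)"
proof (cases "a' = a")
  case True
  have "(\<Prod>b \<in> A - {a}. a - b) \<noteq> 0" using assms by simp
  then show ?thesis using True by (simp add: lagrange_def poly_prod)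
next
  case False
  then have "(\<Prod>b \<in> A - {a}. a' - b) = 0" using assms by (intro prod_zero) auto
  then show ?thesis using False by (simp add: lagrange_def poly_prod)
qed

lemma degree_lagrange:
  assumes "finite A" "a \<in> A"
  shows "degree (lagrange A a) < card A"
proof -
  have "degree (lagrange A a) \<le> card (A - {a})"
    unfolding lagrange_def
    by (rule order.trans[OF degree_smult_le]) (simp add: degree_prod_eq_sum_degree)
  also have "\<dots> < card A" using assms by (rule card_Diff1_less)
  finally show ?thesis .
qed

lemma sum_lagrange:
  assumes "finite A" "A \<noteq> {}"
  shows "(\<Sum>a\<in>A. lagrange A a) = 1"
proof (rule poly_eqI_degree)
  fix x assume "x \<in> A"
  then have "(\<Sum>a\<in>A. poly (lagrange A a) x) = (\<Sum>a\<in>A. if x = a then 1 else 0)"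
    using assms by (intro sum.cong) (auto simp: poly_lagrange)
  then show "poly (\<Sum>a\<in>A. lagrange A a) x = poly 1 x"
    using assms \<open>x \<in> A\<close> by (simp add: poly_sum)
next
  show "degree (\<Sum>a\<in>A. lagrange A a) < card A"
    using assms by (intro degree_sum_less) (auto simp: degree_lagrange card_gt_0_iff)
qed (use assms in \<open>auto simp: card_gt_0_iff\<close>)

text \<open>The missing linear factor completes the node polynomial. Hence, modulo an ideal
  containing the node polynomial, \<open>lagrange A a\<close> is an eigenvector of multiplication by
  the variable, with eigenvalue \<open>a\<close>.\<close>

lemma lagrange_mult_linear:
  assumes "finite A" "a \<in> A"
  shows "[:-a, 1:] * lagrange A a = Polynomial.smult (1 / (\<Prod>b \<in> A - {a}. a - b)) (\<Prod>b \<in> A. [:-b, 1:])"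
  using assms by (simp add: lagrange_def prod.remove)

subsection \<open>Atomic decomposition of a positive functional\<close>

text \<open>The degenerate case of Cauchy-Schwarz: when the functional vanishes on
  \<open>f * f\<close>, its value on the square of \<open>t * f + g\<close> is affine in
  \<open>t\<close>, and an affine function bounded below is constant.\<close>

lemma null_idealI_sq:
  assumes pos: "\<And>f. riesz \<gamma> (f * f) \<ge> 0" and 0: "riesz \<gamma> (f * f) = 0"
  shows "f \<in> null_ideal \<gamma>"
proof -
  have "riesz \<gamma> (f * g) = 0" for g
  proof (rule ccontr)
    assume nz: "riesz \<gamma> (f * g) \<noteq> 0"
    \<comment> \<open>This solves for the parameter at which the affine function takes the value
      -1.\<close>
    define t where "t = - (riesz \<gamma> (g * g) + 1) / (2 * riesz \<gamma> (f * g))"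
    have "(const_xy t * f + g) * (const_xy t * f + g)
        = const_xy t * (const_xy t * (f * f)) + const_xy (t + t) * (f * g) + g * g"
      unfolding single_add by (simp only: ring_distribs ac_simps)
    then have "riesz \<gamma> ((const_xy t * f + g) * (const_xy t * f + g)) = (t + t) * riesz \<gamma> (f * g) + riesz \<gamma> (g * g)"
      by (simp only: riesz_add riesz_const_mult 0)
    also have "\<dots> = -1"
      using nz by (simp add: t_def field_simps)
    finally show False
      using pos[of "const_xy t * f + g"] by simp
  qed
  then show ?thesis by (simp add: null_ideal_def)
qed

text \<open>By positivity the null ideal is real: \<open>f * f\<close> null forces \<open>f\<close>
  null, and a vanishing sum of squares has null summands. So repeated roots and nonreal root pairs
  can be discarded. The induction keeps in \<open>c\<close> the part still to be factored and in
  \<open>B\<close> the distinct real roots found so far.\<close>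

lemma null_ideal_split:
  assumes pos: "\<And>f. riesz \<gamma> (f * f) \<ge> 0"
    and "c \<noteq> 0" "finite B" "poly_subst t (c * (\<Prod>b\<in>B. [:-b, 1:])) \<in> null_ideal \<gamma>"
  shows "\<exists>A. finite A \<and> poly_subst t (\<Prod>a\<in>A. [:-a, 1:]) \<in> null_ideal \<gamma>"
  using assms(2-)
proof (induction "degree c" arbitrary: c B rule: less_induct)
  case less
  let ?\<pi> = "\<lambda>A::real set. \<Prod>a\<in>A. [:-a, 1:]"
  show ?case
  proof (cases "degree c = 0")
    case True
    then obtain k where c: "c = [:k:]" by (rule degree_eq_zeroE)
    with less.prems have "k \<noteq> 0" by simp
    have "const_xy (1 / k) * poly_subst t (c * ?\<pi> B) \<in> null_ideal \<gamma>"
      by (rule null_ideal_mult') (rule less.prems)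
    also have "const_xy (1 / k) * poly_subst t (c * ?\<pi> B) = poly_subst t (?\<pi> B)"
      using \<open>k \<noteq> 0\<close> by (simp add: c flip: poly_subst_smult)
    finally show ?thesis using less.prems by blast
  next
    case False
    then consider (lin) a e where "c = [:-a, 1:] * e"
      | (quad) a b e where "b \<noteq> 0" "c = ([:-a, 1:]^2 + [:b^2:]) * e"
      using real_poly_factor[of c] by blast
    then show ?thesis
    proof cases
      case lin
      then have e: "e \<noteq> 0" using less.prems by auto
      have deg: "degree e < degree c"
        using e by (simp add: lin degree_mult_eq del: mult_pCons_left)
      show ?thesis
      proof (cases "a \<in> B")
        case False
        then have "c * ?\<pi> B = e * ?\<pi> (insert a B)"
          using less.prems by (simp add: lin mult_ac del: mult_pCons_left mult_pCons_right)
        then show ?thesis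
          using less.hyps[OF deg e, of "insert a B"] less.prems by simp
      \<comment> \<open>A repeated root: dropping one copy of its factor leaves \<open>f\<close>,
        whose square is still a multiple of the given null element.\<close>
      next
        case True
        then have B: "?\<pi> B = [:-a, 1:] * ?\<pi> (B - {a})"
          using less.prems by (simp add: prod.remove)
        define f where "f = poly_subst t (e * ?\<pi> B)"
        have "f * f = poly_subst t (c * ?\<pi> B) * poly_subst t (e * ?\<pi> (B - {a}))"
          unfolding f_def poly_subst_mult[symmetric] B lin
          by (rule arg_cong[of _ _ "poly_subst t"]) (simp only: mult_ac)
        then have "f * f \<in> null_ideal \<gamma>"
          using less.prems by (simp add: null_ideal_mult)
        then have "f \<in> null_ideal \<gamma>"
          by (rule null_idealI_sq[OF pos null_ideal_riesz])
        then show ?thesis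
          using less.hyps[OF deg e, of B] less.prems by (simp add: f_def)
      qed
    next
      case quad
      then have e: "e \<noteq> 0" using less.prems by auto
      have Q: "[:-a, 1:]^2 + [:b^2:] = [:a^2 + b^2, - 2 * a, 1:]"
        by (simp add: power2_eq_square)
      have deg: "degree e < degree c"
        using e unfolding quad Q by (subst degree_mult_eq) auto
      define f where "f = poly_subst t (e * ?\<pi> B)"
      define g where "g = poly_subst t ([:-a, 1:] * e * ?\<pi> B)"
      have "g * g + const_xy (b^2) * (f * f) = poly_subst t (c * ?\<pi> B) * f"
        unfolding f_def g_def poly_subst_mult[symmetric] poly_subst_smult[symmetric] poly_subst_add[symmetric]
        by (rule arg_cong[of _ _ "poly_subst t"])
          (simp add: quad(2) algebra_simps power2_eq_square del: mult_pCons_left mult_pCons_right,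
           simp add: smult_add_right)
      also have "\<dots> \<in> null_ideal \<gamma>"
        using less.prems by (simp add: null_ideal_mult)
      finally have "riesz \<gamma> (g * g) + b^2 * riesz \<gamma> (f * f) = 0"
        using null_ideal_riesz by (metis riesz_add riesz_const_mult)
      moreover have "riesz \<gamma> (g * g) \<ge> 0" "b^2 * riesz \<gamma> (f * f) \<ge> 0"
        using pos by simp_all
      ultimately have "riesz \<gamma> (f * f) = 0"
        using quad by (simp add: add_nonneg_eq_0_iff)
      then have "f \<in> null_ideal \<gamma>"
        by (intro null_idealI_sq pos)
      then show ?thesis
        using less.hyps[OF deg e, of B] less.prems by (simp add: f_def)
    qed
  qed
qed

text \<open>The products \<open>E z\<close> of Lagrange polynomials on the grid
  \<open>A \<times> B\<close> sum to 1 and satisfy \<open>f * E z = f(z) * E z\<close>, both modulo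
  the null ideal. Hence \<open>f\<close> is congruent to the sum of the \<open>f(z) * E z\<close>,
  and applying the functional gives the weights. The \<open>E z\<close> are returned as well,
  because the rank computation needs interpolating polynomials.\<close>

lemma riesz_atomic_decomposition:
  assumes pos: "\<And>f. riesz \<gamma> (f * f) \<ge> 0"
    and c: "c\<^sub>1 \<noteq> 0" "poly_subst (monom_xy 1 0) c\<^sub>1 \<in> null_ideal \<gamma>"
      "c\<^sub>2 \<noteq> 0" "poly_subst (monom_xy 0 1) c\<^sub>2 \<in> null_ideal \<gamma>"
  obtains Z w E where "finite Z" "\<And>z. z \<in> Z \<Longrightarrow> w z > 0"
    "\<And>f. riesz \<gamma> f = (\<Sum>z\<in>Z. w z * peval z f)"
    "\<And>z z'. z \<in> Z \<Longrightarrow> z' \<in> Z \<Longrightarrow> peval z' (E z) = (if z' = z then 1 else 0)"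
proof -
  obtain A where A: "finite A" "poly_subst (monom_xy 1 0) (\<Prod>a\<in>A. [:-a, 1:]) \<in> null_ideal \<gamma>"
    using null_ideal_split[OF pos c(1), of "{}" "monom_xy 1 0"] c(2) by auto
  obtain B where B: "finite B" "poly_subst (monom_xy 0 1) (\<Prod>a\<in>B. [:-a, 1:]) \<in> null_ideal \<gamma>"
    using null_ideal_split[OF pos c(3), of "{}" "monom_xy 0 1"] c(4) by auto
  define E where "E = (\<lambda>z. poly_subst (monom_xy 1 0) (lagrange A (fst z))
    * poly_subst (monom_xy 0 1) (lagrange B (snd z)))"
  have E_peval: "peval z' (E z) = (if z' = z then 1 else 0)" if "z \<in> A \<times> B" "z' \<in> A \<times> B" for z z'
    using that A B by (auto simp: E_def peval_mult peval_poly_subst peval_simps poly_lagrange split: if_splits)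
  have lin: "t * poly_subst t (lagrange S a) - const_xy a * poly_subst t (lagrange S a) \<in> null_ideal \<gamma>"
    if "finite S" "a \<in> S" "poly_subst t (\<Prod>a\<in>S. [:-a, 1:]) \<in> null_ideal \<gamma>" for S a t
  proof -
    have "t * poly_subst t (lagrange S a) - const_xy a * poly_subst t (lagrange S a)
        = poly_subst t ([:-a, 1:] * lagrange S a)"
      unfolding poly_subst_mult by (simp add: poly_subst_pCons single_uminus left_diff_distrib)
    also have "\<dots> \<in> null_ideal \<gamma>"
      unfolding lagrange_mult_linear[OF that(1,2)] poly_subst_smult
      by (rule null_ideal_mult') (rule that)
    finally show ?thesis .
  qed
  \<comment> \<open>Being a common eigenvector needs checking for the two variables only; since
    \<open>peval z\<close> is a ring homomorphism, it passes to sums and products.\<close>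
  have E_mult: "f * E z - const_xy (peval z f) * E z \<in> null_ideal \<gamma>" if z: "z \<in> A \<times> B" for f z
  proof (induction f rule: bipoly_ring_induct)
    case (const c)
    then show ?case by (simp add: peval_simps null_ideal_zero)
  next
    case x
    have "(monom_xy 1 0 * poly_subst (monom_xy 1 0) (lagrange A (fst z))
        - const_xy (fst z) * poly_subst (monom_xy 1 0) (lagrange A (fst z)))
        * poly_subst (monom_xy 0 1) (lagrange B (snd z)) \<in> null_ideal \<gamma>"
      using z A by (intro null_ideal_mult lin) auto
    then show ?case by (simp add: E_def peval_simps algebra_simps)
  next
    case y
    have "(monom_xy 0 1 * poly_subst (monom_xy 0 1) (lagrange B (snd z))
        - const_xy (snd z) * poly_subst (monom_xy 0 1) (lagrange B (snd z)))
        * poly_subst (monom_xy 1 0) (lagrange A (fst z)) \<in> null_ideal \<gamma>"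
      using z B by (intro null_ideal_mult lin) auto
    then show ?case by (simp add: E_def peval_simps algebra_simps)
  next
    case (add f g)
    from null_ideal_add[OF add] show ?case
      by (simp add: peval_simps algebra_simps single_add)
  next
    case (mult f g)
    have "f * (g * E z - const_xy (peval z g) * E z)
        + const_xy (peval z g) * (f * E z - const_xy (peval z f) * E z) \<in> null_ideal \<gamma>"
      by (intro null_ideal_add null_ideal_mult' mult)
    moreover have "const_xy (peval z f * peval z g) = const_xy (peval z f) * const_xy (peval z g)"
      by (simp add: mult_single)
    ultimately show ?case
      by (simp add: peval_mult algebra_simps)
  qed
  have E_sum: "1 - (\<Sum>z\<in>A \<times> B. E z) \<in> null_ideal \<gamma>"
  proof (cases "A = {} \<or> B = {}")
    \<comment> \<open>An empty root set has node polynomial 1, so 1 is null and the functional is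
      zero; the empty sum is then the correct value.\<close>
    case True
    then have one: "1 \<in> null_ideal \<gamma>" using A B by auto
    have empty: "A \<times> B = {}" using True by auto
    show ?thesis unfolding empty using one by simp
  next
    case False
    have "(\<Sum>z\<in>A \<times> B. E z) = poly_subst (monom_xy 1 0) (\<Sum>a\<in>A. lagrange A a)
        * poly_subst (monom_xy 0 1) (\<Sum>b\<in>B. lagrange B b)"
      by (simp add: E_def poly_subst_sum sum_product sum.cartesian_product split_def)
    also have "\<dots> = 1" using False A B by (simp add: sum_lagrange)
    finally show ?thesis by (simp add: null_ideal_zero)
  qed
  define w where "w z = riesz \<gamma> (E z)" for z
  have E_riesz: "riesz \<gamma> (f * E z) = w z * peval z f" if "z \<in> A \<times> B" for f z
    using null_ideal_cong_riesz[OF E_mult[OF that]] by (simp add: riesz_const_mult w_def)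
  \<comment> \<open>As \<open>E z\<close> takes the value 1 at \<open>z\<close>, its weight equals
    the value of the functional on \<open>E z * E z\<close>.\<close>
  have w_nonneg: "w z \<ge> 0" if "z \<in> A \<times> B" for z
    using pos[of "E z"] E_riesz[OF that, of "E z"] E_peval[OF that that] by simp
  \<comment> \<open>Grid points of weight zero are dropped, so that the number of atoms is
    exact.\<close>
  define Z where "Z = {z \<in> A \<times> B. w z > 0}"
  have "riesz \<gamma> f = (\<Sum>z\<in>Z. w z * peval z f)" for f
  proof -
    have "f * (1 - (\<Sum>z\<in>A \<times> B. E z)) \<in> null_ideal \<gamma>"
      by (rule null_ideal_mult') (rule E_sum)
    then have "riesz \<gamma> f = riesz \<gamma> (\<Sum>z\<in>A \<times> B. f * E z)"
      by (intro null_ideal_cong_riesz) (simp add: right_diff_distrib sum_distrib_left)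
    also have "\<dots> = (\<Sum>z\<in>A \<times> B. w z * peval z f)"
      by (simp add: riesz_sum E_riesz cong: sum.cong)
    also have "\<dots> = (\<Sum>z\<in>Z. w z * peval z f)"
      by (rule sum.mono_neutral_right) (use A B w_nonneg in \<open>force simp: Z_def\<close>)+
    finally show ?thesis .
  qed
  moreover have "finite Z" "\<And>z. z \<in> Z \<Longrightarrow> w z > 0"
    using A B by (auto simp: Z_def)
  moreover have "peval z' (E z) = (if z' = z then 1 else 0)" if "z \<in> Z" "z' \<in> Z" for z z'
    by (rule E_peval) (use that in \<open>auto simp: Z_def\<close>)
  ultimately show ?thesis using that by blast
qed

subsection \<open>Moment matrices\<close>

lemma set_monomials: "set (monomials d) = {(i, j). i + j \<le> d}"
proof -
  have "(i, j) \<in> set (monomials d)" if "i + j \<le> d" for i j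
    using that unfolding monomials_def set_concat set_map
    by (intro UN_I[of "map (\<lambda>l. (i + j - l, l)) [0..<Suc (i + j)]"]
        image_eqI[of _ _ "i + j"]) (auto intro!: image_eqI[of _ _ j])
  moreover have "i + j \<le> d" if "(i, j) \<in> set (monomials d)" for i j
    using that by (auto simp: monomials_def)
  ultimately show ?thesis by auto
qed

lemma distinct_monomials: "distinct (monomials d)"
proof (induction d)
  case 0
  then show ?case by (simp add: monomials_def)
next
  case (Suc d)
  have "monomials (Suc d) = monomials d @ map (\<lambda>j. (Suc d - j, j)) [0..<Suc (Suc d)]"
    by (simp add: monomials_def)
  moreover have "set (monomials d) \<inter> set (map (\<lambda>j. (Suc d - j, j)) [0..<Suc (Suc d)]) = {}"
    by (auto simp: set_monomials)
  moreover have "distinct (map (\<lambda>j. (Suc d - j, j)) [0..<Suc (Suc d)])"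
    by (subst distinct_map) (auto intro!: inj_onI)
  ultimately show ?case using Suc by (metis distinct_append)
qed

lemma sum_monomials:
  "(\<Sum>r = 0..<length (monomials d). h (monomials d ! r)) = sum h (set (monomials d))"
  by (rule sum.reindex_bij_betw) (use bij_betw_nth[OF distinct_monomials] in \<open>auto simp: atLeast0LessThan\<close>)

lemma polys_upto_keys: "f \<in> polys_upto d \<longleftrightarrow> Poly_Mapping.keys f \<subseteq> set (monomials d)"
  by (auto simp: polys_upto_def set_monomials)

lemma polys_upto_mono: "d \<le> e \<Longrightarrow> polys_upto d \<subseteq> polys_upto e"
  by (fastforce simp: polys_upto_def)

lemma polys_upto_single: "i + j \<le> d \<Longrightarrow> Poly_Mapping.single (i, j) c \<in> polys_upto d"
  by (simp add: polys_upto_def)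

lemma polys_upto_zero: "0 \<in> polys_upto d"
  by (simp add: polys_upto_def)

lemma polys_upto_add: "f \<in> polys_upto d \<Longrightarrow> g \<in> polys_upto d \<Longrightarrow> f + g \<in> polys_upto d"
  using keys_add[of f g] by (auto simp: polys_upto_keys)

lemma polys_upto_sum: "(\<And>i. i \<in> I \<Longrightarrow> f i \<in> polys_upto d) \<Longrightarrow> sum f I \<in> polys_upto d"
  by (induction I rule: infinite_finite_induct) (auto intro: polys_upto_zero polys_upto_add)

lemma polys_upto_mult: "f \<in> polys_upto d \<Longrightarrow> g \<in> polys_upto e \<Longrightarrow> f * g \<in> polys_upto (d + e)"
  using keys_mult[of f g] by (fastforce simp: polys_upto_def)

lemma polys_upto_const_mult: "f \<in> polys_upto d \<Longrightarrow> const_xy c * f \<in> polys_upto d"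
  using polys_upto_mult[of "const_xy c" 0 f d] polys_upto_single[of 0 0 0 c]
  by (simp add: zero_prod_def)

lemma coeff_vec_carrier [simp]: "coeff_vec d f \<in> carrier_vec (length (monomials d))"
  by (simp add: coeff_vec_def)

lemma moment_matrix_carrier [simp]:
  "moment_matrix d \<gamma> \<in> carrier_mat (length (monomials d)) (length (monomials d))"
  by (simp add: moment_matrix_def)

lemmas moment_matrix_dim [simp] = carrier_matD[OF moment_matrix_carrier]

lemma coeff_vec_surj:
  assumes "v \<in> carrier_vec (length (monomials d))"
  obtains f where "f \<in> polys_upto d" "coeff_vec d f = v"
proof
  let ?N = "length (monomials d)"
  define f where "f = (\<Sum>r = 0..<?N. Poly_Mapping.single (monomials d ! r) (v $ r))"
  have "monomials d ! r \<in> set (monomials d)" if "r < ?N" for r using that by simp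
  then show "f \<in> polys_upto d"
    unfolding f_def by (intro polys_upto_sum) (auto simp: polys_upto_keys)
  have "Poly_Mapping.lookup f (monomials d ! s) = v $ s" if "s < ?N" for s
  proof -
    have "Poly_Mapping.lookup f (monomials d ! s) = (\<Sum>r = 0..<?N. if r = s then v $ s else 0)"
      unfolding f_def lookup_sum
      by (rule sum.cong)
        (use that distinct_monomials[of d] in \<open>auto simp: lookup_single when_def nth_eq_iff_index_eq\<close>)
    then show ?thesis using that by simp
  qed
  then show "coeff_vec d f = v"
    using assms by (auto simp: coeff_vec_def)
qed

lemma moment_matrix_mult_coeff_vec:
  assumes "g \<in> polys_upto d" "r < length (monomials d)"
  shows "(moment_matrix d \<gamma> *\<^sub>v coeff_vec d g) $ r
    = riesz \<gamma> (monom_xy (fst (monomials d ! r)) (snd (monomials d ! r)) * g)"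
proof -
  let ?k = "monomials d ! r"
  let ?S = "set (monomials d)"
  have "riesz \<gamma> (monom_xy (fst ?k) (snd ?k) * g) = (\<Sum>l\<in>?S.
      Poly_Mapping.lookup g l * \<gamma> (fst ?k + fst l) (snd ?k + snd l))"
    using assms by (subst riesz_mult[of "{?k}" _ ?S])
      (auto simp: monom_xy_def polys_upto_keys)
  then show ?thesis
    using assms(2) by (simp add: moment_matrix_def coeff_vec_def scalar_prod_def mult.commute
        flip: sum_monomials)
qed

text \<open>This identifies the moment matrix as the Gram matrix of the form
  \<open>riesz \<gamma> (f * g)\<close> on polynomials of degree at most \<open>d\<close>,
  translating between matrices and the functional.\<close>

lemma moment_matrix_form:
  assumes "f \<in> polys_upto d" "g \<in> polys_upto d"
  shows "coeff_vec d f \<bullet> (moment_matrix d \<gamma> *\<^sub>v coeff_vec d g) = riesz \<gamma> (f * g)"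
proof -
  let ?S = "set (monomials d)"
  have "coeff_vec d f \<bullet> (moment_matrix d \<gamma> *\<^sub>v coeff_vec d g)
      = (\<Sum>r = 0..<length (monomials d). Poly_Mapping.lookup f (monomials d ! r) *
          riesz \<gamma> (monom_xy (fst (monomials d ! r)) (snd (monomials d ! r)) * g))"
    unfolding scalar_prod_def
    by (rule sum.cong) (use assms(2) in \<open>simp_all add: moment_matrix_mult_coeff_vec coeff_vec_def[of d f]
      del: index_mult_mat_vec\<close>)
  also have "\<dots> = (\<Sum>k\<in>?S. Poly_Mapping.lookup f k * riesz \<gamma> (monom_xy (fst k) (snd k) * g))"
    by (rule sum_monomials)
  also have "\<dots> = (\<Sum>k\<in>Poly_Mapping.keys f. Poly_Mapping.lookup f k * riesz \<gamma> (monom_xy (fst k) (snd k) * g))"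
    by (rule sum.mono_neutral_right) (use assms in \<open>auto simp: polys_upto_keys in_keys_iff\<close>)
  also have "\<dots> = riesz \<gamma> (\<Sum>k\<in>Poly_Mapping.keys f. Poly_Mapping.single k (Poly_Mapping.lookup f k) * g)"
    by (subst const_monom_xy) (simp add: riesz_sum mult.assoc riesz_const_mult)
  also have "\<dots> = riesz \<gamma> (f * g)"
    by (simp flip: sum_distrib_right bipoly_expand)
  finally show ?thesis .
qed

lemma psd_moment_matrix_iff:
  "psd_mat (moment_matrix d \<gamma>) \<longleftrightarrow> (\<forall>f \<in> polys_upto d. riesz \<gamma> (f * f) \<ge> 0)"
proof
  assume "psd_mat (moment_matrix d \<gamma>)"
  then show "\<forall>f \<in> polys_upto d. riesz \<gamma> (f * f) \<ge> 0"
    unfolding psd_mat_def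
    by (metis coeff_vec_carrier moment_matrix_carrier moment_matrix_form carrier_matD(1))
next
  assume *: "\<forall>f \<in> polys_upto d. riesz \<gamma> (f * f) \<ge> 0"
  have "0 \<le> v \<bullet> (moment_matrix d \<gamma> *\<^sub>v v)" if v: "v \<in> carrier_vec (length (monomials d))" for v
    using coeff_vec_surj[OF v] moment_matrix_form * by metis
  moreover have "transpose_mat (moment_matrix d \<gamma>) = moment_matrix d \<gamma>"
    by (auto simp: moment_matrix_def add.commute)
  ultimately show "psd_mat (moment_matrix d \<gamma>)"
    by (auto simp: psd_mat_def moment_matrix_def)
qed

section \<open>Ranks and measures of atomic functionals\<close>

lemma (in vec_space) rank_eq_card:
  assumes A: "A \<in> carrier_mat n nc" and S: "finite S" "S \<subseteq> carrier_vec n" "lin_indpt S"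
    and col: "col_space A = span S"
  shows "rank A = card S"
proof -
  have "maximal S (\<lambda>T. T \<subseteq> S \<and> lin_indpt T)"
    using S by (auto simp: maximal_def)
  then have "vectorspace.dim class_ring (span_vs S) = card S"
    using S by (intro dim_span) auto
  then show ?thesis
    using col unfolding rank_def col_space_def by simp
qed

text \<open>The moment matrix is the sum over the atoms of \<open>w z\<close> times the outer square
  of \<open>ev z\<close>, the vector of monomials evaluated at \<open>z\<close>. Interpolating
  polynomials of degree at most \<open>d\<close> show that the vectors \<open>ev z\<close> are
  independent and lie in the column space, so they form a basis of it.\<close>

lemma rank_moment_matrix_atomic:
  assumes Z: "finite Z" "\<And>z. z \<in> Z \<Longrightarrow> w z \<noteq> 0"
    and rep: "\<And>f. riesz \<gamma> f = (\<Sum>z\<in>Z. w z * peval z f)"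
    and E: "\<And>z. z \<in> Z \<Longrightarrow> E z \<in> polys_upto d"
      "\<And>z z'. z \<in> Z \<Longrightarrow> z' \<in> Z \<Longrightarrow> peval z' (E z) = (if z' = z then 1 else 0)"
  shows "mat_rank (moment_matrix d \<gamma>) = card Z"
proof -
  let ?N = "length (monomials d)" and ?M = "moment_matrix d \<gamma>"
  interpret vec_space "TYPE(real)" ?N .
  define ev where "ev z = Matrix.vec ?N (\<lambda>r. peval z (monom_xy (fst (monomials d ! r)) (snd (monomials d ! r))))"
    for z
  have ev_carrier [simp]: "ev z \<in> carrier_vec ?N" for z by (simp add: ev_def)
  have ev_prod: "coeff_vec d f \<bullet> ev z = peval z f" if "f \<in> polys_upto d" for f z
  proof -
    have "coeff_vec d f \<bullet> ev z = (\<Sum>k\<in>set (monomials d). Poly_Mapping.lookup f k * peval z (monom_xy (fst k) (snd k)))"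
      by (simp add: scalar_prod_def coeff_vec_def ev_def flip: sum_monomials)
    also have "\<dots> = peval z f"
      using that unfolding peval_def
      by (subst (2) riesz_superset[of "set (monomials d)"])
        (simp_all add: polys_upto_keys monom_xy_def riesz_single)
    finally show ?thesis .
  qed
  have M_mult: "(?M *\<^sub>v coeff_vec d g) $ r = (\<Sum>z\<in>Z. (w z * peval z g) * ev z $ r)"
    if "g \<in> polys_upto d" "r < ?N" for g r
    using that by (simp add: moment_matrix_mult_coeff_vec rep peval_mult ev_def mult_ac del: index_mult_mat_vec)
  have inj: "inj_on ev Z"
  proof (rule inj_onI, rule ccontr)
    fix z z' assume "z \<in> Z" "z' \<in> Z" "ev z = ev z'" "z \<noteq> z'"
    then show False using ev_prod[OF E(1)[of z], of z] ev_prod[OF E(1)[of z], of z'] E(2)[of z z] E(2)[of z z']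
      by simp
  qed
  have sub: "ev ` Z \<subseteq> carrier_vec ?N" by auto
  have indpt: "lin_indpt (ev ` Z)"
  proof (rule finite_lin_indpt2)
    fix a assume a: "lincomb a (ev ` Z) = 0\<^sub>v ?N"
    have "a (ev z) = 0" if z: "z \<in> Z" for z
    proof -
      \<comment> \<open>Pairing with the coefficient vector of \<open>E z\<close> evaluates
        \<open>E z\<close> at every atom and isolates one coefficient of the combination.\<close>
      have "0 = coeff_vec d (E z) \<bullet> lincomb a (ev ` Z)"
        by (simp add: a)
      also have "\<dots> = (\<Sum>r = 0..<?N. coeff_vec d (E z) $ r * (\<Sum>v\<in>ev ` Z. a v * v $ r))"
        using lincomb_dim[OF _ sub, of a] Z by (simp add: scalar_prod_def lincomb_index[OF _ sub])
      also have "\<dots> = (\<Sum>v\<in>ev ` Z. a v * (\<Sum>r = 0..<?N. coeff_vec d (E z) $ r * v $ r))"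
        by (simp add: sum_distrib_left mult_ac, subst sum.swap, simp add: mult_ac)
      also have "\<dots> = (\<Sum>z'\<in>Z. a (ev z') * (coeff_vec d (E z) \<bullet> ev z'))"
        by (subst sum.reindex[OF inj]) (simp add: scalar_prod_def ev_def)
      also have "\<dots> = (\<Sum>z'\<in>Z. if z' = z then a (ev z') else 0)"
        using z by (intro sum.cong) (auto simp: ev_prod E)
      also have "\<dots> = a (ev z)" using z Z by simp
      finally show ?thesis by simp
    qed
    then show "\<forall>v\<in>ev ` Z. a v = 0" by blast
  qed (use Z in auto)
  have "col_space ?M = span (ev ` Z)"
  proof (rule antisym)
    show "col_space ?M \<subseteq> span (ev ` Z)"
    proof
      fix v assume "v \<in> col_space ?M"
      then obtain u where u: "u \<in> carrier_vec ?N" "v = ?M *\<^sub>v u"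
        unfolding col_space_eq[OF moment_matrix_carrier] by (auto simp: moment_matrix_def)
      then obtain g where g: "g \<in> polys_upto d" "u = coeff_vec d g" using coeff_vec_surj by metis
      \<comment> \<open>\<open>lincomb\<close> indexes coefficients by vectors, so the atom must be
        recovered from its evaluation vector.\<close>
      define a where "a v = (let z = the_inv_into Z ev v in w z * peval z g)" for v
      have "v = lincomb a (ev ` Z)"
      proof (rule eq_vecI)
        show "dim_vec v = dim_vec (lincomb a (ev ` Z))"
          using lincomb_dim[OF _ sub, of a] Z u by (simp add: moment_matrix_def)
      next
        fix r assume "r < dim_vec (lincomb a (ev ` Z))"
        then have r: "r < ?N" using lincomb_dim[OF _ sub, of a] Z by simp
        show "v $ r = lincomb a (ev ` Z) $ r"
          unfolding lincomb_index[OF r sub] sum.reindex[OF inj]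
          using r by (simp add: u(2) g M_mult a_def the_inv_into_f_f[OF inj] del: index_mult_mat_vec)
      qed
      then show "v \<in> span (ev ` Z)" using Z by (intro in_spanI) auto
    qed
    have "ev z \<in> col_space ?M" if z: "z \<in> Z" for z
    proof -
      \<comment> \<open>Applied to the coefficients of \<open>E z\<close>, the matrix keeps only the
        term of the atom \<open>z\<close>, scaled by its weight.\<close>
      have "?M *\<^sub>v ((1 / w z) \<cdot>\<^sub>v coeff_vec d (E z)) = ev z"
      proof (rule eq_vecI)
        fix r assume "r < dim_vec (ev z)"
        then have r: "r < ?N" by (simp add: ev_def)
        have "(?M *\<^sub>v ((1 / w z) \<cdot>\<^sub>v coeff_vec d (E z))) $ r = (1 / w z) * (\<Sum>z'\<in>Z. (w z' * peval z' (E z)) * ev z' $ r)"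
          unfolding M_mult[OF E(1)[OF z] r, symmetric]
          using r by (simp add: mult_mat_vec[OF moment_matrix_carrier] del: index_mult_mat_vec)
        also have "(\<Sum>z'\<in>Z. (w z' * peval z' (E z)) * ev z' $ r) = (\<Sum>z'\<in>Z. if z' = z then w z * ev z $ r else 0)"
          using z by (intro sum.cong) (auto simp: E)
        finally show "(?M *\<^sub>v ((1 / w z) \<cdot>\<^sub>v coeff_vec d (E z))) $ r = ev z $ r"
          using z Z by simp
      qed (simp add: ev_def moment_matrix_def)
      then show ?thesis
        unfolding col_space_eq[OF moment_matrix_carrier]
        by (auto simp: moment_matrix_def intro!: bexI[of _ "(1 / w z) \<cdot>\<^sub>v coeff_vec d (E z)"])
    qed
    then have "ev ` Z \<subseteq> span (set (cols ?M))" by (auto simp: col_space_def)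
    then show "span (ev ` Z) \<subseteq> col_space ?M"
      unfolding col_space_def using cols_dim[of ?M] by (intro span_subsetI) (auto simp: moment_matrix_def)
  qed
  then have "rank ?M = card (ev ` Z)"
    by (intro rank_eq_card[OF moment_matrix_carrier _ sub indpt]) (use Z in auto)
  then show ?thesis using card_image[OF inj] by (simp add: moment_matrix_def)
qed

lemma ex_finite_atomic_measure:
  assumes Z: "finite Z" "\<And>z. z \<in> Z \<Longrightarrow> w z > 0"
    and rep: "\<And>f. riesz \<gamma> f = (\<Sum>z\<in>Z. w z * peval z f)"
  shows "\<exists>\<mu>. representing_measure d \<gamma> \<mu> \<and> atomic (card Z) \<mu>"
proof -
  let ?P = "point_measure Z (\<lambda>z. ennreal (w z))"
  \<comment> \<open>Pushing forward along the identity replaces the discrete sigma-algebra on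
    \<open>Z\<close> by the Borel sets of the plane.\<close>
  define \<mu> :: "(real \<times> real) measure" where "\<mu> = distr ?P borel (\<lambda>z. z)"
  have [measurable]: "(\<lambda>z. z) \<in> measurable ?P borel" by simp
  have emeasure: "emeasure \<mu> U = (\<Sum>z\<in>U \<inter> Z. ennreal (w z))" if "U \<in> sets borel" for U
    unfolding \<mu>_def using that Z
    by (subst emeasure_distr) (auto simp: space_point_measure intro!: emeasure_point_measure_finite)
  have "measure_support \<mu> = Z"
  proof (intro equalityI subsetI)
    fix z assume z: "z \<in> measure_support \<mu>"
    have "open (- Z)" using Z finite_imp_closed by auto
    then have "emeasure \<mu> (- Z) = 0" by (subst emeasure) auto
    then show "z \<in> Z"
      using z \<open>open (- Z)\<close> unfolding measure_support_def by fastforce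
  next
    fix z assume z: "z \<in> Z"
    have "emeasure \<mu> U > 0" if "open U" "z \<in> U" for U
    proof -
      have "0 < ennreal (w z)" using Z z by simp
      also have "\<dots> \<le> (\<Sum>z\<in>U \<inter> Z. ennreal (w z))"
        using that z Z by (intro member_le_sum) auto
      finally show ?thesis using that by (simp add: emeasure)
    qed
    then show "z \<in> measure_support \<mu>" by (simp add: measure_support_def)
  qed
  moreover have "representing_measure d \<gamma> \<mu>"
    unfolding representing_measure_def
  proof (intro conjI allI impI)
    fix i j
    have meas: "(\<lambda>z. fst z ^ i * snd z ^ j) \<in> borel_measurable (borel :: (real \<times> real) measure)"
      by (intro borel_measurable_continuous_onI continuous_intros)
    show "integrable \<mu> (\<lambda>(x, y). x ^ i * y ^ j)"
      unfolding \<mu>_def split_def using Z meas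
      by (subst integrable_distr_eq) (simp_all add: integrable_point_measure_finite)
    have "(\<integral>(x, y). x ^ i * y ^ j \<partial>\<mu>) = (\<Sum>z\<in>Z. w z * (fst z ^ i * snd z ^ j))"
      unfolding \<mu>_def split_def using Z meas
      by (subst integral_distr) (simp_all add: lebesgue_integral_point_measure_finite less_imp_le)
    also have "\<dots> = riesz \<gamma> (monom_xy i j)"
      by (simp add: rep peval_simps)
    finally show "\<gamma> i j = (\<integral>(x, y). x ^ i * y ^ j \<partial>\<mu>)"
      by (simp add: monom_xy_def riesz_single)
  qed (simp add: \<mu>_def)
  ultimately show ?thesis using Z by (auto simp: atomic_def)
qed

text \<open>Modulo the null ideal everything reduces to the finite-dimensional space of polynomials
  of degree at most \<open>d\<close>. One more power of \<open>t\<close> than its dimension must be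
  linearly dependent there.\<close>

lemma ex_annihilating_poly:
  assumes red: "\<And>f. \<exists>g \<in> polys_upto d. f - g \<in> null_ideal \<gamma>"
  shows "\<exists>c. c \<noteq> 0 \<and> poly_subst t c \<in> null_ideal \<gamma>"
proof -
  let ?N = "length (monomials d)"
  obtain G where G: "\<And>k. G k \<in> polys_upto d" "\<And>k. t ^ k - G k \<in> null_ideal \<gamma>"
    using choice[of "\<lambda>k g. g \<in> polys_upto d \<and> t ^ k - g \<in> null_ideal \<gamma>"] red by blast
  \<comment> \<open>The rows hold the coefficients of the reduced powers. An added zero column makes
    the matrix square and singular, and a kernel vector of the transpose is the desired
    dependence.\<close>
  define B where "B = Matrix.mat (Suc ?N) (Suc ?N)
    (\<lambda>(k, r). if r < ?N then Poly_Mapping.lookup (G k) (monomials d ! r) else 0)"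
  have B: "B \<in> carrier_mat (Suc ?N) (Suc ?N)" by (simp add: B_def)
  have "B *\<^sub>v unit_vec (Suc ?N) ?N = 0\<^sub>v (Suc ?N)"
    by (rule eq_vecI) (auto simp: B_def scalar_prod_def unit_vec_def intro!: sum.neutral)
  moreover have "unit_vec (Suc ?N) ?N \<noteq> (0\<^sub>v (Suc ?N) :: real Matrix.vec)"
    by (rule unit_vec_nonzero) simp
  ultimately have "det B = 0"
    using det_0_iff_vec_prod_zero[OF B] unit_vec_carrier by blast
  then have "det (transpose_mat B) = 0" using det_transpose[OF B] by simp
  then obtain v where v: "v \<in> carrier_vec (Suc ?N)" "v \<noteq> 0\<^sub>v (Suc ?N)"
    "transpose_mat B *\<^sub>v v = 0\<^sub>v (Suc ?N)"
    using det_0_iff_vec_prod_zero[of "transpose_mat B" "Suc ?N"] B by auto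
  have rel: "(\<Sum>k<Suc ?N. const_xy (v $ k) * G k) = 0"
  proof (rule poly_mapping_eqI)
    fix l
    have lookup: "Poly_Mapping.lookup (const_xy a * f) l = a * Poly_Mapping.lookup f l" for a and f :: bipoly
      by (induction f rule: bipoly_induct) (auto simp: mult_single lookup_single lookup_add algebra_simps when_def)
    have "(\<Sum>k<Suc ?N. v $ k * Poly_Mapping.lookup (G k) l) = 0"
    proof (cases "l \<in> set (monomials d)")
      case True
      then obtain r where r: "r < ?N" "l = monomials d ! r" by (metis in_set_conv_nth)
      have "(\<Sum>k<Suc ?N. v $ k * Poly_Mapping.lookup (G k) l) = (transpose_mat B *\<^sub>v v) $ r"
        using r v(1) by (simp add: B_def scalar_prod_def mult.commute lessThan_atLeast0)
      then show ?thesis using v(3) r by simp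
    next
      case False
      then have "Poly_Mapping.lookup (G k) l = 0" for k
        using G(1)[of k] by (auto simp: polys_upto_keys in_keys_iff)
      then show ?thesis by simp
    qed
    then show "Poly_Mapping.lookup (\<Sum>k<Suc ?N. const_xy (v $ k) * G k) l = Poly_Mapping.lookup 0 l"
      by (simp only: lookup_sum lookup lookup_zero)
  qed
  define c where "c = (\<Sum>k<Suc ?N. Polynomial.monom (v $ k) k)"
  have "\<exists>k<Suc ?N. v $ k \<noteq> 0"
  proof (rule ccontr)
    assume "\<not> ?thesis"
    then have "v = 0\<^sub>v (Suc ?N)" using v(1) by (intro eq_vecI) auto
    then show False using v(2) by simp
  qed
  then obtain k where k: "k < Suc ?N" "v $ k \<noteq> 0" by blast
  have "Polynomial.coeff c k = (\<Sum>l<Suc ?N. if l = k then v $ k else 0)"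
    unfolding c_def coeff_sum by (rule sum.cong) auto
  then have "Polynomial.coeff c k = v $ k"
    using k by (simp del: sum.lessThan_Suc)
  then have "c \<noteq> 0" using k by auto
  have "poly_subst t c = (\<Sum>k<Suc ?N. const_xy (v $ k) * (t ^ k - G k))"
    using rel by (simp add: c_def poly_subst_sum poly_subst_monom right_diff_distrib sum_subtractf del: sum.lessThan_Suc)
  also have "\<dots> \<in> null_ideal \<gamma>"
    by (intro null_ideal_sum null_ideal_mult' G)
  finally show ?thesis using \<open>c \<noteq> 0\<close> by blast
qed

text \<open>Reduction modulo the null ideal yields annihilating polynomials for both variables,
  hence atoms. It also brings the interpolating polynomials down to degree \<open>d\<close>, so the
  rank is the number of atoms from \<open>d\<close> onwards.\<close>

lemma flat_functional_atomic:
  assumes pos: "\<And>f. riesz \<gamma> (f * f) \<ge> 0"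
    and red: "\<And>f. \<exists>g \<in> polys_upto d. f - g \<in> null_ideal \<gamma>"
  obtains Z w where "finite Z" "\<And>z. z \<in> Z \<Longrightarrow> w z > 0"
    "\<And>f. riesz \<gamma> f = (\<Sum>z\<in>Z. w z * peval z f)"
    "\<And>e. d \<le> e \<Longrightarrow> mat_rank (moment_matrix e \<gamma>) = card Z"
proof -
  obtain c\<^sub>1 where c1: "c\<^sub>1 \<noteq> 0" "poly_subst (monom_xy 1 0) c\<^sub>1 \<in> null_ideal \<gamma>"
    using ex_annihilating_poly[OF red] by metis
  obtain c\<^sub>2 where c2: "c\<^sub>2 \<noteq> 0" "poly_subst (monom_xy 0 1) c\<^sub>2 \<in> null_ideal \<gamma>"
    using ex_annihilating_poly[OF red] by metis
  obtain Z w E where Z: "finite Z" "\<And>z. z \<in> Z \<Longrightarrow> w z > 0"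
    and rep: "\<And>f. riesz \<gamma> f = (\<Sum>z\<in>Z. w z * peval z f)"
    and E: "\<And>z z'. z \<in> Z \<Longrightarrow> z' \<in> Z \<Longrightarrow> peval z' (E z) = (if z' = z then 1 else 0)"
    by (rule riesz_atomic_decomposition[OF pos c1 c2]) (rule that)
  obtain F where F: "\<And>z. F z \<in> polys_upto d" "\<And>z. E z - F z \<in> null_ideal \<gamma>"
    using choice[of "\<lambda>z g. g \<in> polys_upto d \<and> E z - g \<in> null_ideal \<gamma>"] red by blast
  \<comment> \<open>For null \<open>f\<close> the weighted sum of the squares \<open>f(z)^2\<close>
    is zero with positive weights. Hence replacing \<open>E z\<close> by its reduction
    \<open>F z\<close> changes no value at an atom.\<close>
  have null: "peval z f = 0" if f: "f \<in> null_ideal \<gamma>" and "z \<in> Z" for f z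
  proof -
    have "(\<Sum>z\<in>Z. w z * (peval z f * peval z f)) = 0"
      using null_ideal_riesz[OF null_ideal_mult[OF f, of f]] by (simp add: rep peval_mult)
    then have "w z * (peval z f * peval z f) = 0"
      using Z that by (subst (asm) sum_nonneg_eq_0_iff) (auto simp: less_imp_le)
    then show ?thesis using Z(2)[OF that(2)] by simp
  qed
  have "mat_rank (moment_matrix e \<gamma>) = card Z" if "d \<le> e" for e
  proof (rule rank_moment_matrix_atomic[OF Z(1) _ rep])
    show "F z \<in> polys_upto e" for z using F polys_upto_mono[OF that] by blast
    show "peval z' (F z) = (if z' = z then 1 else 0)" if "z \<in> Z" "z' \<in> Z" for z z'
      using null[OF F(2)[of z] that(2)] E[OF that] by (simp add: peval_simps)
  qed (use Z(2) in force)
  then show ?thesis using that Z rep by blast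
qed

subsection \<open>The recursive extension\<close>

text \<open>The degree guards only secure termination: under the hypotheses on \<open>p\<close> and \<open>q\<close> they always hold.\<close>

function recursive_extension ::
  "nat \<Rightarrow> nat \<Rightarrow> bipoly \<Rightarrow> bipoly \<Rightarrow> (nat \<Rightarrow> nat \<Rightarrow> real) \<Rightarrow> nat \<Rightarrow> nat \<Rightarrow> real" where
  "recursive_extension n m p q \<beta> i j =
    (if n \<le> i then \<Sum>k \<in> Poly_Mapping.keys p. if fst k + snd k < n
       then Poly_Mapping.lookup p k * recursive_extension n m p q \<beta> (i - n + fst k) (j + snd k) else 0
     else if m \<le> j then \<Sum>k \<in> Poly_Mapping.keys q. if fst k + snd k \<le> m \<and> snd k < m
       then Poly_Mapping.lookup q k * recursive_extension n m p q \<beta> (i + fst k) (j - m + snd k) else 0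
     else \<beta> i j)"
  by pat_completeness auto
termination
  by (relation "measures [\<lambda>(n, m, p, q, \<beta>, i, j). i + j, \<lambda>(n, m, p, q, \<beta>, i, j). j]") auto

declare recursive_extension.simps [simp del]

text \<open>The order matches the recursion: \<open>x^n = p\<close> lowers the total degree, while
  \<open>y^m = q\<close> may preserve it but then lowers the exponent of \<open>y\<close>.\<close>

lemma degree_lex_induct [case_names less]:
  fixes i j :: nat
  assumes "\<And>i j. (\<And>i' j'. i' + j' < i + j \<or> i' + j' \<le> i + j \<and> j' < j \<Longrightarrow> P i' j') \<Longrightarrow> P i j"
  shows "P i j"
proof -
  have "wf (measures [\<lambda>(i, j). i + j, \<lambda>(i::nat, j::nat). j])" by simp
  then have "case z of (i, j) \<Rightarrow> P i j" for z
  proof (induction z rule: wf_induct_rule)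
    case (less z)
    obtain i j where z: "z = (i, j)" by fastforce
    have "P i j"
      by (rule assms) (use less[of "(_, _)"] in \<open>auto simp: z le_less\<close>)
    then show ?case by (simp add: z)
  qed
  from this[of "(i, j)"] show ?thesis by simp
qed

lemma monom_mult_expand:
  "monom_xy i j * f = (\<Sum>k \<in> Poly_Mapping.keys f.
    const_xy (Poly_Mapping.lookup f k) * monom_xy (i + fst k) (j + snd k))"
proof -
  have "monom_xy i j * f = (\<Sum>k \<in> Poly_Mapping.keys f. monom_xy i j * Poly_Mapping.single k (Poly_Mapping.lookup f k))"
    by (subst (1) bipoly_expand) (rule sum_distrib_left)
  also have "\<dots> = (\<Sum>k \<in> Poly_Mapping.keys f.
    const_xy (Poly_Mapping.lookup f k) * monom_xy (i + fst k) (j + snd k))"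
    by (rule sum.cong[OF refl], subst const_monom_xy, subst mult.left_commute) (simp add: monom_xy_mult)
  finally show ?thesis .
qed

lemma riesz_monom: "riesz \<gamma> (monom_xy i j) = \<gamma> i j"
  by (simp add: monom_xy_def riesz_single)

lemma riesz_monom_mult:
  "riesz \<gamma> (monom_xy i j * f) = (\<Sum>k \<in> Poly_Mapping.keys f. Poly_Mapping.lookup f k * \<gamma> (i + fst k) (j + snd k))"
  by (simp add: monom_mult_expand riesz_sum riesz_const_mult riesz_monom)

text \<open>The kernel only contains multiples of \<open>h\<close> of degree at most
  \<open>d\<close>. Up to degree \<open>2 * d\<close>, a monomial multiple factors as such a kernel
  element times a monomial of degree at most \<open>d\<close>, and the value is then an entry of a
  zero vector.\<close>

lemma riesz_generated_relation:
  assumes ker: "\<And>i j. i + j + n \<le> d \<Longrightarrow> coeff_vec d (monom_xy i j * h) \<in> mat_kernel (moment_matrix d \<beta>)"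
    and h: "h \<in> polys_upto n" and "n \<le> d" "i + j + n \<le> 2 * d"
  shows "riesz \<beta> (monom_xy i j * h) = 0"
proof -
  \<comment> \<open>As much of the monomial as fits into degree \<open>d - n\<close> stays with
    \<open>h\<close>, first powers of \<open>x\<close>, then powers of \<open>y\<close>. Whatever
    remains has degree at most \<open>d\<close>.\<close>
  define i2 where "i2 = min i (d - n)"
  define j2 where "j2 = min j (d - n - i2)"
  have split: "i2 \<le> i" "j2 \<le> j" "i2 + j2 + n \<le> d" "(i - i2) + (j - j2) \<le> d"
    using assms(3,4) unfolding i2_def j2_def by linarith+
  let ?g = "monom_xy i2 j2 * h"
  have "monom_xy i2 j2 \<in> polys_upto (i2 + j2)"
    by (simp add: monom_xy_def polys_upto_single)
  then have g: "?g \<in> polys_upto d"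
    using polys_upto_mult[OF _ h] polys_upto_mono[OF split(3)] by blast
  have f: "monom_xy (i - i2) (j - j2) \<in> polys_upto d"
    unfolding monom_xy_def by (rule polys_upto_single[OF split(4)])
  have "monom_xy i j * h = monom_xy (i - i2) (j - j2) * ?g"
    using split by (simp add: monom_xy_mult flip: mult.assoc)
  then have "riesz \<beta> (monom_xy i j * h)
      = coeff_vec d (monom_xy (i - i2) (j - j2)) \<bullet> (moment_matrix d \<beta> *\<^sub>v coeff_vec d ?g)"
    by (simp only: moment_matrix_form[OF f g])
  also have "moment_matrix d \<beta> *\<^sub>v coeff_vec d ?g = 0\<^sub>v (length (monomials d))"
    using ker[OF split(3)] by (simp add: mat_kernel_def)
  finally show ?thesis by (simp add: coeff_vec_def scalar_prod_def)
qed

section \<open>Compatibility of the two recursions and reduction to normal form\<close>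

locale recursive_relations =
  fixes n m :: nat and p q :: bipoly and \<beta> :: "nat \<Rightarrow> nat \<Rightarrow> real"
  assumes n: "1 \<le> n" and m: "1 \<le> m"
    and p: "p \<in> polys_upto (n - 1)" and q: "q \<in> polys_upto m"
    and q_low: "\<forall>(u, v) \<in> Poly_Mapping.keys q. v < m"
begin

abbreviation "\<gamma> \<equiv> recursive_extension n m p q \<beta>"

lemma p_keys: "k \<in> Poly_Mapping.keys p \<Longrightarrow> fst k + snd k < n"
  using p n by (fastforce simp: polys_upto_def)

lemma q_keys: "k \<in> Poly_Mapping.keys q \<Longrightarrow> fst k + snd k \<le> m \<and> snd k < m"
  using q q_low by (fastforce simp: polys_upto_def)

lemma recursive_extension_base: "i < n \<Longrightarrow> j < m \<Longrightarrow> \<gamma> i j = \<beta> i j"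
  by (subst recursive_extension.simps) simp

lemma recursive_extension_x: "\<gamma> (n + i) j = riesz \<gamma> (monom_xy i j * p)"
  by (subst recursive_extension.simps) (simp add: riesz_monom_mult p_keys cong: sum.cong)

text \<open>Where both rules could apply, the definition uses the one for \<open>x\<close>; the
  relation for \<open>y\<close> in the range \<open>n \<le> i\<close> is obtained in
  \<open>null_ideal_y\<close>.\<close>

lemma recursive_extension_y: "i < n \<Longrightarrow> \<gamma> i (m + j) = riesz \<gamma> (monom_xy i j * q)"
  by (subst recursive_extension.simps) (simp add: riesz_monom_mult q_keys cong: sum.cong)

lemma null_ideal_x: "monom_xy n 0 - p \<in> null_ideal \<gamma>"
proof (rule null_ideal_monomI)
  fix i j
  have "(monom_xy n 0 - p) * monom_xy i j = monom_xy (n + i) j - monom_xy i j * p"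
    by (subst mult.commute) (simp add: right_diff_distrib monom_xy_mult add.commute)
  then show "riesz \<gamma> ((monom_xy n 0 - p) * monom_xy i j) = 0"
    by (simp add: riesz_diff riesz_monom recursive_extension_x)
qed

text \<open>For \<open>i < n\<close> this is the recursion itself. For larger \<open>i\<close>, a
  factor \<open>x^n\<close> may be replaced by \<open>p\<close>, since that relation is already
  null, and \<open>p\<close> has degree below \<open>n\<close>; the total degree of the multiplier
  drops and induction applies.\<close>

lemma null_ideal_y: "monom_xy 0 m - q \<in> null_ideal \<gamma>"
proof (rule null_ideal_monomI)
  fix i j
  show "riesz \<gamma> ((monom_xy 0 m - q) * monom_xy i j) = 0"
  proof (induction i j rule: degree_lex_induct)
    case (less i j)
    show ?case
    proof (cases "n \<le> i")
      case False
      have "(monom_xy 0 m - q) * monom_xy i j = monom_xy i (m + j) - monom_xy i j * q"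
        by (subst mult.commute) (simp add: right_diff_distrib monom_xy_mult add.commute)
      then show ?thesis
        using False by (simp add: riesz_diff riesz_monom recursive_extension_y)
    next
      case True
      let ?h = "monom_xy 0 m - q"
      have "monom_xy i j = monom_xy n 0 * monom_xy (i - n) j"
        using True by (simp add: monom_xy_mult)
      then have "?h * monom_xy i j - ?h * (monom_xy (i - n) j * p)
          = (monom_xy n 0 - p) * (?h * monom_xy (i - n) j)"
        by (simp add: algebra_simps)
      also have "\<dots> \<in> null_ideal \<gamma>"
        by (rule null_ideal_mult) (rule null_ideal_x)
      finally have "riesz \<gamma> (?h * monom_xy i j) = riesz \<gamma> (?h * (monom_xy (i - n) j * p))"
        by (rule null_ideal_cong_riesz)
      also have "?h * (monom_xy (i - n) j * p) = (\<Sum>k\<in>Poly_Mapping.keys p.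
          const_xy (Poly_Mapping.lookup p k) * (?h * monom_xy (i - n + fst k) (j + snd k)))"
        by (simp add: monom_mult_expand sum_distrib_left mult.left_commute)
      also have "riesz \<gamma> \<dots> = (\<Sum>k\<in>Poly_Mapping.keys p.
          Poly_Mapping.lookup p k * riesz \<gamma> (?h * monom_xy (i - n + fst k) (j + snd k)))"
        by (simp add: riesz_sum riesz_const_mult)
      also have "\<dots> = 0"
      proof (rule sum.neutral, rule ballI)
        fix k assume "k \<in> Poly_Mapping.keys p"
        then have "(i - n + fst k) + (j + snd k) < i + j"
          using p_keys[of k] True by linarith
        then show "Poly_Mapping.lookup p k * riesz \<gamma> (?h * monom_xy (i - n + fst k) (j + snd k)) = 0"
          using less by simp
      qed
      finally show ?thesis .
    qed
  qed
qed

text \<open>Rewriting \<open>x^n\<close> to \<open>p\<close> and \<open>y^m\<close> to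
  \<open>q\<close> stops at monomials with exponents below \<open>n\<close> and \<open>m\<close>, of
  degree at most \<open>n + m - 2\<close>. This is where the relation between \<open>d\<close>,
  \<open>n\<close> and \<open>m\<close> enters.\<close>

lemma reduce_monom:
  assumes d: "n + m \<le> d + 2"
  shows "\<exists>g \<in> polys_upto d. monom_xy i j - g \<in> null_ideal \<gamma>"
proof (induction i j rule: degree_lex_induct)
  case (less i j)
  \<comment> \<open>One rewriting step, stated for a general leading monomial so that it serves both
    relations.\<close>
  have step: "\<exists>g \<in> polys_upto d. monom_xy i j - g \<in> null_ideal \<gamma>"
    if h: "h = monom_xy a b - f" "h \<in> null_ideal \<gamma>" and ab: "a \<le> i" "b \<le> j"
      and keys: "\<And>k. k \<in> Poly_Mapping.keys f \<Longrightarrow> fst k + snd k < a + b \<or> fst k + snd k \<le> a + b \<and> snd k < b"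
    for a b h f
  proof -
    have "\<exists>g. g \<in> polys_upto d \<and> monom_xy (i - a + fst k) (j - b + snd k) - g \<in> null_ideal \<gamma>"
      if "k \<in> Poly_Mapping.keys f" for k
    proof -
      have "(i - a + fst k) + (j - b + snd k) < i + j \<or>
          (i - a + fst k) + (j - b + snd k) \<le> i + j \<and> j - b + snd k < j"
        using keys[OF that] ab by linarith
      then show ?thesis using less by blast
    qed
    then obtain G where G: "\<And>k. k \<in> Poly_Mapping.keys f \<Longrightarrow> G k \<in> polys_upto d"
      "\<And>k. k \<in> Poly_Mapping.keys f \<Longrightarrow> monom_xy (i - a + fst k) (j - b + snd k) - G k \<in> null_ideal \<gamma>"
      by metis
    define g where "g = (\<Sum>k\<in>Poly_Mapping.keys f. const_xy (Poly_Mapping.lookup f k) * G k)"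
    have "g \<in> polys_upto d"
      unfolding g_def by (intro polys_upto_sum polys_upto_const_mult G)
    have "monom_xy i j = monom_xy (i - a) (j - b) * monom_xy a b"
      using ab by (simp add: monom_xy_mult)
    then have "monom_xy i j - g = h * monom_xy (i - a) (j - b) + (monom_xy (i - a) (j - b) * f - g)"
      by (simp add: h(1) algebra_simps)
    also have "monom_xy (i - a) (j - b) * f - g = (\<Sum>k\<in>Poly_Mapping.keys f.
        const_xy (Poly_Mapping.lookup f k) * (monom_xy (i - a + fst k) (j - b + snd k) - G k))"
      by (simp add: monom_mult_expand g_def right_diff_distrib sum_subtractf)
    also have "h * monom_xy (i - a) (j - b) + \<dots> \<in> null_ideal \<gamma>"
      by (intro null_ideal_add null_ideal_mult h(2) null_ideal_sum null_ideal_mult' G)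
    finally show ?thesis using \<open>g \<in> polys_upto d\<close> by blast
  qed
  consider "n \<le> i" | "i < n" "m \<le> j" | "i < n" "j < m" by linarith
  then show ?case
  proof cases
    case 1
    then show ?thesis
      by (intro step[OF refl null_ideal_x]) (use p_keys in auto)
  next
    case 2
    then show ?thesis
      by (intro step[OF refl null_ideal_y]) (use q_keys in auto)
  next
    case 3
    then have "monom_xy i j \<in> polys_upto d"
      unfolding monom_xy_def using d by (intro polys_upto_single) linarith
    then show ?thesis using null_ideal_zero by force
  qed
qed

lemma reduce:
  assumes d: "n + m \<le> d + 2"
  shows "\<exists>g \<in> polys_upto d. f - g \<in> null_ideal \<gamma>"
proof (induction f rule: bipoly_induct)
  case (single k c)
  obtain g where g: "g \<in> polys_upto d" "monom_xy (fst k) (snd k) - g \<in> null_ideal \<gamma>"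
    using reduce_monom[OF d] by blast
  have "const_xy c * g \<in> polys_upto d"
    by (rule polys_upto_const_mult) (rule g)
  moreover have "Poly_Mapping.single k c - const_xy c * g \<in> null_ideal \<gamma>"
    using null_ideal_mult'[OF g(2), of "const_xy c"]
    by (subst const_monom_xy) (simp add: right_diff_distrib)
  ultimately show ?case by blast
next
  case (add f g)
  then obtain f' g' where "f' \<in> polys_upto d" "f - f' \<in> null_ideal \<gamma>" "g' \<in> polys_upto d" "g - g' \<in> null_ideal \<gamma>"
    by blast
  then show ?case
    using null_ideal_add[of "f - f'" \<gamma> "g - g'"] polys_upto_add[of f' d g']
    by (intro bexI[of _ "f' + g'"]) (simp_all add: algebra_simps)
qed

text \<open>Up to degree \<open>e\<close>, \<open>\<beta>\<close> obeys the same recursion as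
  \<open>\<gamma>\<close> with the same initial values, and neither rule raises the degree.\<close>

lemma recursive_extension_extends:
  assumes x: "\<And>i j. i + j + n \<le> e \<Longrightarrow> riesz \<beta> (monom_xy i j * (monom_xy n 0 - p)) = 0"
    and y: "\<And>i j. i + j + m \<le> e \<Longrightarrow> riesz \<beta> (monom_xy i j * (monom_xy 0 m - q)) = 0"
  shows "i + j \<le> e \<Longrightarrow> \<gamma> i j = \<beta> i j"
proof (induction i j rule: degree_lex_induct)
  case (less i j)
  consider "n \<le> i" | "i < n" "m \<le> j" | "i < n" "j < m" by linarith
  then show ?case
  proof cases
    case 1
    then obtain a where i: "i = n + a" using le_Suc_ex by blast
    have "\<gamma> i j = riesz \<gamma> (monom_xy a j * p)"
      by (simp add: i recursive_extension_x)
    also have "\<dots> = riesz \<beta> (monom_xy a j * p)"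
      unfolding riesz_monom_mult
    proof (rule sum.cong)
      fix k assume "k \<in> Poly_Mapping.keys p"
      then have "(a + fst k) + (j + snd k) < i + j" using p_keys[of k] i by linarith
      then show "Poly_Mapping.lookup p k * \<gamma> (a + fst k) (j + snd k) = Poly_Mapping.lookup p k * \<beta> (a + fst k) (j + snd k)"
        using less by simp
    qed simp
    also have "\<dots> = \<beta> i j"
      using x[of a j] less.prems
      by (simp add: i right_diff_distrib riesz_diff monom_xy_mult riesz_monom add.commute)
    finally show ?thesis .
  next
    case 2
    then obtain b where j: "j = m + b" using le_Suc_ex by blast
    have "\<gamma> i j = riesz \<gamma> (monom_xy i b * q)"
      using 2 by (simp add: j recursive_extension_y)
    also have "\<dots> = riesz \<beta> (monom_xy i b * q)"
      unfolding riesz_monom_mult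
    proof (rule sum.cong)
      fix k assume "k \<in> Poly_Mapping.keys q"
      then have "(i + fst k) + (b + snd k) \<le> i + j \<and> b + snd k < j" using q_keys[of k] j by linarith
      then show "Poly_Mapping.lookup q k * \<gamma> (i + fst k) (b + snd k) = Poly_Mapping.lookup q k * \<beta> (i + fst k) (b + snd k)"
        using less by simp
    qed simp
    also have "\<dots> = \<beta> i j"
      using y[of i b] less.prems
      by (simp add: j right_diff_distrib riesz_diff monom_xy_mult riesz_monom add.commute)
    finally show ?thesis .
  qed (simp add: recursive_extension_base)
qed

end

theorem corollary2p4:
  fixes d n m :: nat
    and \<beta> :: "nat \<Rightarrow> nat \<Rightarrow> real"
    and p q :: bipoly
  assumes "d \<ge> 1"
    and "1 \<le> n" "n \<le> d"
    and "1 \<le> m" "m \<le> d"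
    and "p \<in> polys_upto (n - 1)"
    and "q \<in> polys_upto m"
    and "\<forall>(u, v) \<in> Poly_Mapping.keys q. v < m"
    and "psd_mat (moment_matrix d \<beta>)"
    and "relations_generated d \<beta> n p m q"
    and "int d = int n + int m - 2"
  shows "(\<exists>\<beta>'. flat_extension d \<beta> \<beta>') \<and>
         (\<exists>\<mu>. representing_measure d \<beta> \<mu> \<and> atomic (mat_rank (moment_matrix d \<beta>)) \<mu>)"
proof -
  interpret recursive_relations n m p q \<beta>
    by unfold_locales (use assms in auto)
  interpret V: vec_space "TYPE(real)" "length (monomials d)" .
  have d: "n + m \<le> d + 2" using assms(11) by linarith
  let ?S = "{coeff_vec d (monom_xy i j * (monom_xy n 0 - p)) | i j. i + j + n \<le> d} \<union>
    {coeff_vec d (monom_xy k l * (monom_xy 0 m - q)) | k l. k + l + m \<le> d}"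
  have "?S \<subseteq> V.span ?S" by (rule V.in_own_span) auto
  then have "?S \<subseteq> mat_kernel (moment_matrix d \<beta>)"
    using assms(10) unfolding relations_generated_def by simp
  then have ker_x: "\<And>i j. i + j + n \<le> d \<Longrightarrow>
      coeff_vec d (monom_xy i j * (monom_xy n 0 - p)) \<in> mat_kernel (moment_matrix d \<beta>)"
    and ker_y: "\<And>i j. i + j + m \<le> d \<Longrightarrow>
      coeff_vec d (monom_xy i j * (monom_xy 0 m - q)) \<in> mat_kernel (moment_matrix d \<beta>)"
    by blast+
  have diff: "f - g \<in> polys_upto e" if "f \<in> polys_upto e" "g \<in> polys_upto e" for f g e
    using that polys_upto_add[of f e "- g"] by (simp add: polys_upto_def)
  have "monom_xy 0 m - q \<in> polys_upto m" "monom_xy n 0 - p \<in> polys_upto n"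
    using assms polys_upto_mono[of "n - 1" n] by (auto intro!: diff polys_upto_single simp: monom_xy_def)
  have "riesz \<beta> (monom_xy i j * (monom_xy n 0 - p)) = 0" if "i + j + n \<le> 2 * d" for i j
    using riesz_generated_relation[OF ker_x _ assms(3) that] \<open>monom_xy n 0 - p \<in> polys_upto n\<close> by blast
  moreover have "riesz \<beta> (monom_xy i j * (monom_xy 0 m - q)) = 0" if "i + j + m \<le> 2 * d" for i j
    using riesz_generated_relation[OF ker_y _ assms(5) that] \<open>monom_xy 0 m - q \<in> polys_upto m\<close> by blast
  ultimately have ext: "\<gamma> i j = \<beta> i j" if "i + j \<le> 2 * d" for i j
    using that by (rule recursive_extension_extends)
  have riesz_ext: "riesz \<gamma> f = riesz \<beta> f" if "f \<in> polys_upto (2 * d)" for f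
    unfolding riesz_def by (rule sum.cong) (use that ext in \<open>auto simp: polys_upto_def\<close>)
  \<comment> \<open>Congruent polynomials have congruent squares, so it suffices to test degree at
    most \<open>d\<close>; there the square has degree at most \<open>2 * d\<close>, where
    positivity of the given moment matrix applies.\<close>
  have pos: "riesz \<gamma> (f * f) \<ge> 0" for f
  proof -
    obtain g where g: "g \<in> polys_upto d" "f - g \<in> null_ideal \<gamma>" using reduce[OF d] by blast
    have "f * f - g * g = (f - g) * (f + g)" by (simp add: algebra_simps)
    then have "f * f - g * g \<in> null_ideal \<gamma>" using null_ideal_mult[OF g(2)] by simp
    then have "riesz \<gamma> (f * f) = riesz \<gamma> (g * g)" by (rule null_ideal_cong_riesz)
    also have "\<dots> = riesz \<beta> (g * g)"
      using polys_upto_mult[OF g(1) g(1)] by (simp add: riesz_ext mult_2)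
    finally show ?thesis using assms(9) g(1) by (simp add: psd_moment_matrix_iff)
  qed
  obtain Z w where Z: "finite Z" "\<And>z. z \<in> Z \<Longrightarrow> w z > 0"
    and rep: "\<And>f. riesz \<gamma> f = (\<Sum>z\<in>Z. w z * peval z f)"
    and rank: "\<And>e. d \<le> e \<Longrightarrow> mat_rank (moment_matrix e \<gamma>) = card Z"
    by (rule flat_functional_atomic[OF pos reduce[OF d]]) (rule that)
  have deg: "fst (monomials d ! r) + snd (monomials d ! r) \<le> d" if "r < length (monomials d)" for r
    using nth_mem[OF that] by (auto simp: set_monomials)
  have "moment_matrix d \<gamma> = moment_matrix d \<beta>"
  proof (rule eq_matI)
    fix r c assume "r < dim_row (moment_matrix d \<beta>)" "c < dim_col (moment_matrix d \<beta>)"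
    then show "moment_matrix d \<gamma> $$ (r, c) = moment_matrix d \<beta> $$ (r, c)"
      using deg[of r] deg[of c] by (simp add: moment_matrix_def ext)
  qed simp_all
  then have rank_eq: "mat_rank (moment_matrix d \<beta>) = card Z" using rank[of d] by simp
  \<comment> \<open>The ranks in degrees \<open>d\<close> and \<open>d + 1\<close> both equal the
    number of atoms, and positivity holds in every degree.\<close>
  have "flat_extension d \<beta> \<gamma>"
    unfolding flat_extension_def
    using ext pos rank[of "d + 1"] rank_eq by (auto simp: psd_moment_matrix_iff)
  moreover obtain \<mu> where "representing_measure d \<gamma> \<mu>" "atomic (card Z) \<mu>"
    using ex_finite_atomic_measure[OF Z rep] by blast
  then have "representing_measure d \<beta> \<mu> \<and> atomic (mat_rank (moment_matrix d \<beta>)) \<mu>"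
    unfolding rank_eq using ext by (simp add: representing_measure_def)
  ultimately show ?thesis by blast
qed

end
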